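(* Let $r\in\mathbb{N}$, $\mathbf{m}=(m_1,\dots,m_r)\in\mathbb{N}^r$, $m=m_1+\cdots+m_r$, $\mathbf{f}\in\mathbb{C}^r$, $A,B,C,D\in\mathbb{C}$, and let $E$ be a negative integer. Then $$ F\left(\begin{matrix} A,\;1+A/2,\;B,\;C,\;D,\;E,\;\hat{\boldsymbol\eta}+1 \\ A/2,\;1+A-B,\;1+A-C,\;1+A-D,\;1+A-E,\;\hat{\boldsymbol\eta} \end{matrix}\,\Big|\,-1\right) $$ $$ =\frac{\Gamma(1+A-C-D-E)\Gamma(1+A-C)\Gamma(1+A-D)\Gamma(1+A-E)}{\Gamma(1+A)\Gamma(1+A-C-D)\Gamma(1+A-D-E)\Gamma(1+A-C-E)}\; F\left(\begin{matrix} C,\;D,\;E,\;\mathbf{f}+\mathbf{m} \\ 1+A-B,\;C+D+E-A,\;\mathbf{f} \end{matrix}\,\Big|\,1\right), $$ where $\hat{\boldsymbol\eta}$ is the vector of the $2m$ zeros of the polynomial $$ \hat{R}_{2m}(t;A,B,\mathbf{f},\mathbf{m})=\sum_{k=0}^{m}\frac{(\mathbf{f})_{\mathbf{m}}(t)_{k}(A-t)_{k}}{(B)_k\,k!}\;{}_{r+1}F_{r}\left(\begin{matrix} -k,\mathbf{f}+\mathbf{m} \\ \mathbf{f} \end{matrix}\,\Big|\,1\right). $$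
   Context: Notation: $(a)_n=\Gamma(a+n)/\Gamma(a)$; for vectors $(\mathbf{a})_n=\prod_j(a_j)_n$, $(\mathbf{f})_{\mathbf{m}}=\prod_i(f_i)_{m_i}$, and $\mathbf{a}+\beta$ means adding $\beta$ to each component. $F\left(\begin{smallmatrix} \mathbf{a} \\ \mathbf{b} \end{smallmatrix}\big|x\right)=\sum_{n\ge0}\frac{(\mathbf{a})_n}{(\mathbf{b})_n n!}x^n$ is the generalized hypergeometric function. Zeros are listed with multiplicity. Standing convention: lower parameters are never non-positive integers, denominators occurring do not vanish, and the Gamma functions occurring are not evaluated at poles. *)

theory Defs
  imports "HOL-Analysis.Analysis" "HOL-Computational_Algebra.Computational_Algebra"
begin

definition hypergeo :: "complex list \<Rightarrow> complex list \<Rightarrow> complex \<Rightarrow> complex" where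
  "hypergeo as bs x = eval_fps (fps_hypergeo as bs 1) x"

lemma foldl_mult_eq_prod_list:
  fixes g :: "'a \<Rightarrow> 'b::comm_monoid_mult"
  shows "foldl (\<lambda>r a. r * g a) c xs = c * prod_list (map g xs)"
  by (induction xs arbitrary: c) (simp_all add: mult.assoc)

lemma hypergeo_eq_suminf:
  "hypergeo as bs x =
     (\<Sum>n. prod_list (map (\<lambda>a. pochhammer a n) as) /
          (prod_list (map (\<lambda>b. pochhammer b n) bs) * fact n) * x ^ n)"
  by (simp add: hypergeo_def eval_fps_def foldl_mult_eq_prod_list)

definition shift_params :: "complex list \<Rightarrow> nat list \<Rightarrow> complex list" where
  "shift_params fs ms = map2 (\<lambda>f m. f + of_nat m) fs ms"

definition pochhammer_vec :: "complex list \<Rightarrow> nat list \<Rightarrow> complex" where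
  "pochhammer_vec fs ms = prod_list (map2 pochhammer fs ms)"

text \<open>The polynomial is taken in the variable \<open>t\<close>, represented by \<open>[:0, 1:]\<close>,
  so that \<open>A - t\<close> is \<open>[:A, - 1:]\<close>.\<close>

definition R_hat :: "complex \<Rightarrow> complex \<Rightarrow> complex list \<Rightarrow> nat list \<Rightarrow> complex poly" where
  "R_hat A B fs ms =
     (\<Sum>k\<le>sum_list ms.
        smult (pochhammer_vec fs ms / (pochhammer B k * fact k) *
               hypergeo (- of_nat k # shift_params fs ms) fs 1)
          (pochhammer [:0, 1:] k * pochhammer [:A, - 1:] k))"

lemma poly_R_hat:
  "poly (R_hat A B fs ms) t =
     (\<Sum>k\<le>sum_list ms.
        pochhammer_vec fs ms * pochhammer t k * pochhammer (A - t) k /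
        (pochhammer B k * fact k) *
        hypergeo (- of_nat k # shift_params fs ms) fs 1)"
proof -
  have "poly (pochhammer p k) t = pochhammer (poly p t) k" for p :: "complex poly" and k
    by (simp add: pochhammer_prod poly_prod)
  then show ?thesis
    by (simp add: R_hat_def poly_sum field_simps)
qed

end

theory Submission
  imports Defs
begin

text \<open>
  The shifted parameters \<open>\<eta> + 1\<close> over \<open>\<eta>\<close> contribute the factor \<open>R(-n) / R(0)\<close> to the \<open>n\<close>-th term
  on the left. Since \<open>E\<close> is a negative integer both series are finite sums, and the identity is an
  instance of Bailey's lemma: the inner sum over the very well-poised terms is a
  summable 4F3 at \<open>-1\<close> (shifted by \<open>k\<close> for the \<open>k\<close>-th summand of \<open>R\<close>), the inner sum in the other
  direction is Saalschuetz's 3F2. The polynomial \<open>(f + m)\<^sub>j / (f)\<^sub>j\<close> in \<open>j\<close> has degree at most \<open>m\<close>,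
  so Newton's interpolation formula recovers it from its finite differences at \<open>0\<close>, which are, up
  to sign, the values \<open>F(-k, f + m; f; 1)\<close> appearing in \<open>R\<close>.
\<close>

section \<open>Two classical terminating sums: Saalschuetz's 3F2 and the well-poised 4F3 at
  -1\<close>

lemma Suc_times_choose_Suc: "Suc j * (n choose Suc j) = (n - j) * (n choose j)"
  by (metis binomial_absorption binomial_absorb_comp)

text \<open>
  This and the next sum are proved by creative telescoping: the first-order recurrence in the upper
  limit holds termwise up to a difference of the WZ certificate \<open>g\<close>.
\<close>

lemma saalschuetz:
  fixes a b c :: "'a :: field_char_0"
  shows "(\<Sum>j\<le>M. of_nat (M choose j) * pochhammer a j * pochhammer b j *
            pochhammer (c + of_nat j) (M - j) * pochhammer (c - a - b) (M - j)) =
         pochhammer (c - a) M * pochhammer (c - b) M"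
proof (induction M)
  case 0
  then show ?case by simp
next
  case (Suc M)
  \<comment> \<open>\<open>t\<close> is the term of 3F2(-M, a, b; c, 1 + a + b - c - M; 1)
    multiplied by (c)_M (c - a - b)_M, which makes it polynomial in a, b, c. \<open>q\<close> is the
    factor the right-hand side gains from M to M + 1.\<close>
  define t where "t = (\<lambda>M j. of_nat (M choose j) * pochhammer a j * pochhammer b j *
            pochhammer (c + of_nat j) (M - j) * pochhammer (c - a - b) (M - j))"
  define q where "q = (c - a + of_nat M) * (c - b + of_nat M)"
  define g where "g = (\<lambda>j. (a + of_nat j) * (b + of_nat j) * t M j)"
  have t0: "t M j = 0" if "j > M" for j
    using that by (simp add: t_def)
  have step: "t (Suc M) (Suc j) = q * t M (Suc j) - (g (Suc j) - g j)" if j: "j \<le> M" for j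
  \<comment> \<open>At j = M the top term of the longer sum has no counterpart in
    \<open>t M\<close>; it equals \<open>g M\<close>.\<close>
  proof (cases "j = M")
    case True
    then show ?thesis
      by (simp add: t_def g_def q_def pochhammer_Suc)
  next
    case False
    \<comment> \<open>Writing M = j + d + 1 removes all truncated subtractions. Every term is then a
      multiple of the common factor \<open>K\<close>, and what remains is a polynomial identity
      modulo the relation \<open>XY\<close> between neighbouring binomials.\<close>
    then obtain d where d: "M = Suc (j + d)"
      using j by (metis le_neq_implies_less less_iff_Suc_add)
    define K where "K = pochhammer a (Suc j) * pochhammer b (Suc j) *
        pochhammer (c + of_nat (Suc j)) d * pochhammer (c - a - b) d"
    define X Y J e :: 'a where "X = of_nat (M choose j)" and "Y = of_nat (M choose Suc j)"
      and "J = of_nat j" and "e = of_nat d"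
    define x where "x = c - a - b"
    have XY: "(J + 1) * Y = (e + 1) * X"
    proof -
      have "Suc j * (M choose Suc j) = Suc d * (M choose j)"
        using Suc_times_choose_Suc[of j M] d by simp
      then have "of_nat (Suc j * (M choose Suc j)) = (of_nat (Suc d * (M choose j)) :: 'a)"
        by simp
      then show ?thesis
        by (simp add: X_def Y_def J_def e_def algebra_simps)
    qed
    have M: "of_nat M = J + e + 1"
      by (simp add: d J_def e_def)
    have 1: "t (Suc M) (Suc j) = (X + Y) * K * (c + J + e + 1) * (x + e)"
      unfolding t_def K_def X_def Y_def J_def e_def x_def
      by (simp add: d pochhammer_Suc algebra_simps)
    have 2: "t M (Suc j) = Y * K"
      unfolding t_def K_def Y_def by (simp add: d)
    have 3: "g j = X * K * (c + J) * (x + e)"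
    proof -
      have "pochhammer (c + of_nat j) (Suc d) = (c + of_nat j) * pochhammer (c + of_nat (Suc j)) d"
        by (simp add: pochhammer_rec add_ac)
      moreover have "M - j = Suc d" using d by simp
      ultimately show ?thesis
        unfolding g_def t_def K_def X_def J_def e_def x_def
        by (simp add: pochhammer_Suc algebra_simps)
    qed
    have 4: "g (Suc j) = (a + J + 1) * (b + J + 1) * (Y * K)"
      unfolding g_def 2 by (simp add: J_def add_ac)
    have "(X + Y) * (c + J + e + 1) * (x + e) =
          q * Y - ((a + J + 1) * (b + J + 1) * Y - X * (c + J) * (x + e))"
      using XY unfolding q_def x_def M by algebra
    then show ?thesis unfolding 1 2 3 4 by algebra
  qed
  have "(\<Sum>j\<le>Suc M. t (Suc M) j) = t (Suc M) 0 + (\<Sum>j\<le>M. t (Suc M) (Suc j))"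
    by (rule sum.atMost_Suc_shift)
  also have "(\<Sum>j\<le>M. t (Suc M) (Suc j)) = q * (\<Sum>j\<le>M. t M (Suc j)) - (\<Sum>j\<le>M. g (Suc j) - g j)"
    by (simp add: step sum_subtractf sum_distrib_left)
  also have "(\<Sum>j\<le>M. g (Suc j) - g j) = g (Suc M) - g 0"
    by (induction M) auto
  also have "(\<Sum>j\<le>M. t M (Suc j)) = (\<Sum>j\<le>M. t M j) - t M 0"
    using sum.atMost_Suc_shift[of "t M" M] by (simp add: t0)
  also have "g (Suc M) = 0"
    by (simp add: g_def t0)
  \<comment> \<open>The term j = 0 obeys the same recurrence with the missing \<open>g\<close> at -1
    read as 0: (c + M) (c - a - b + M) = q - a b.\<close>
  also have "t (Suc M) 0 + (q * ((\<Sum>j\<le>M. t M j) - t M 0) - (0 - g 0)) = q * (\<Sum>j\<le>M. t M j)"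
    by (simp add: g_def t_def q_def pochhammer_Suc algebra_simps)
  also have "(\<Sum>j\<le>M. t M j) = pochhammer (c - a) M * pochhammer (c - b) M"
    using Suc.IH by (simp add: t_def)
  finally show ?case
    by (simp add: t_def q_def pochhammer_Suc mult_ac)
qed

lemma well_poised_4F3:
  fixes A B :: "'a :: field_char_0"
  assumes A: "\<And>n. pochhammer (1 + A) n \<noteq> 0"
  shows "(\<Sum>r\<le>j. of_nat (j choose r) * (A + 2 * of_nat r) * pochhammer A r * pochhammer B r *
            pochhammer (1 + A - B + of_nat r) (j - r) / pochhammer (1 + A) (j + r)) = A"
proof (induction j)
  case 0
  then show ?case by simp
next
  case (Suc j)
  \<comment> \<open>The right-hand side is independent of j, so the recurrence has factor 1. The
    certificate \<open>g\<close> is a rational multiple of \<open>u\<close>, the term without its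
    very well-poised factor A + 2r.\<close>
  define u where "u = (\<lambda>j r. of_nat (j choose r) * pochhammer A r * pochhammer B r *
            pochhammer (1 + A - B + of_nat r) (j - r) / pochhammer (1 + A) (j + r))"
  define F where "F = (\<lambda>j r. (A + 2 * of_nat r) * u j r)"
  define g where "g = (\<lambda>r. (A + of_nat r) * (B + of_nat r) * u j r / (1 + A + of_nat (j + r)))"
  have nz: "1 + A + of_nat n \<noteq> 0" for n
    using A[of "Suc n"] by (simp add: pochhammer_Suc)
  have u0: "u j r = 0" if "r > j" for r
    using that by (simp add: u_def)
  have step: "F (Suc j) (Suc r) = F j (Suc r) - (g (Suc r) - g r)" if r: "r \<le> j" for r
  proof (cases "r = j")
    case True
    \<comment> \<open>A + 2(j + 1) is also the last factor of (1 + A)_(2j+2), so it cancels the very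
      well-poised factor of the top term.\<close>
    have w: "A + 2 * of_nat (Suc j) \<noteq> 0" "1 + A + of_nat (j + j) \<noteq> 0"
      using nz[of "2 * j + 1"] nz[of "j + j"] by (simp_all add: algebra_simps)
    have p: "pochhammer (1 + A) (Suc j + Suc j) =
             pochhammer (1 + A) (j + j) * (1 + A + of_nat (j + j)) * (A + 2 * of_nat (Suc j))"
      by (simp add: pochhammer_Suc algebra_simps)
    have "F (Suc j) (Suc j) = g j"
      using w A[of "j + j"] unfolding F_def g_def u_def p
      by (simp add: pochhammer_Suc del: of_nat_Suc of_nat_add)
    moreover have "F j (Suc j) = 0" "g (Suc j) = 0"
      by (simp_all add: F_def g_def u0)
    ultimately show ?thesis
      using True by simp
  next
    case False
    then obtain d where d: "j = Suc (r + d)"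
      using r by (metis le_neq_implies_less less_iff_Suc_add)
    \<comment> \<open>\<open>K\<close> carries the longest denominator occurring, (1 + A)_(j+r+2);
      terms with a shorter one pick up the missing linear factor.\<close>
    define K where "K = pochhammer A (Suc r) * pochhammer B (Suc r) *
        pochhammer (1 + A - B + of_nat (Suc r)) d / pochhammer (1 + A) (Suc (Suc (j + r)))"
    define X Y R e :: 'a where "X = of_nat (j choose r)" and "Y = of_nat (j choose Suc r)"
      and "R = of_nat r" and "e = of_nat d"
    have XY: "(R + 1) * Y = (e + 1) * X"
    proof -
      have "Suc r * (j choose Suc r) = Suc d * (j choose r)"
        using Suc_times_choose_Suc[of r j] d by simp
      then have "of_nat (Suc r * (j choose Suc r)) = (of_nat (Suc d * (j choose r)) :: 'a)"
        by simp
      then show ?thesis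
        by (simp add: X_def Y_def R_def e_def algebra_simps)
    qed
    have J: "of_nat j = R + e + 1"
      by (simp add: d R_def e_def)
    have p: "pochhammer (1 + A) (Suc (Suc (j + r))) =
             pochhammer (1 + A) (j + r) * (1 + A + of_nat (j + r)) * (1 + A + of_nat (Suc (j + r)))"
      by (simp add: pochhammer_Suc)
    have nn: "of_nat (j + r) = 2 * R + e + 1" "of_nat (Suc (j + r)) = 2 * R + e + 2"
      using J by (simp_all add: R_def)
    have nz1: "1 + A + (2 * R + e + 1) \<noteq> 0" "1 + A + (2 * R + e + 2) \<noteq> 0"
      using nz[of "j + r"] nz[of "Suc (j + r)"] unfolding nn .
    have pn: "pochhammer (1 + A) (j + r) \<noteq> 0" by (rule A)
    have 1: "u (Suc j) (Suc r) = (X + Y) * K * (1 + A - B + R + e + 1)"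
    proof -
      have "Suc j - Suc r = Suc d" "Suc j + Suc r = Suc (Suc (j + r))" using d by simp_all
      then have "u (Suc j) (Suc r) = of_nat (Suc j choose Suc r) * pochhammer A (Suc r) *
          pochhammer B (Suc r) * pochhammer (1 + A - B + of_nat (Suc r)) (Suc d) /
          pochhammer (1 + A) (Suc (Suc (j + r)))"
        by (simp only: u_def)
      also have "pochhammer (1 + A - B + of_nat (Suc r)) (Suc d) =
          pochhammer (1 + A - B + of_nat (Suc r)) d * (1 + A - B + R + e + 1)"
        by (simp add: pochhammer_Suc R_def e_def add_ac)
      also have "of_nat (Suc j choose Suc r) = X + Y"
        by (simp add: X_def Y_def)
      finally show ?thesis
        by (simp add: K_def mult_ac)
    qed
    have 2: "u j (Suc r) = Y * K * (1 + A + (2 * R + e + 2))"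
    proof -
      have "j - Suc r = d" "j + Suc r = Suc (j + r)" using d by simp_all
      then have "u j (Suc r) = Y * pochhammer A (Suc r) * pochhammer B (Suc r) *
          pochhammer (1 + A - B + of_nat (Suc r)) d /
          (pochhammer (1 + A) (j + r) * (1 + A + of_nat (j + r)))"
        by (simp only: u_def Y_def pochhammer_Suc[of "1 + A" "j + r"])
      then show ?thesis
        using pn nz1 unfolding K_def p nn by (simp del: of_nat_Suc)
    qed
    have 3: "(A + R) * (B + R) * u j r / (1 + A + (2 * R + e + 1)) = X * K * (1 + A - B + R) * (1 + A + (2 * R + e + 2))"
    proof -
      have "pochhammer (1 + A - B + of_nat r) (Suc d) = (1 + A - B + of_nat r) * pochhammer (1 + A - B + of_nat (Suc r)) d"
        by (simp add: pochhammer_rec add_ac)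
      moreover have "j - r = Suc d" using d by simp
      ultimately show ?thesis
        using pn nz1
        unfolding u_def K_def X_def p nn
        by (simp add: pochhammer_Suc[of A] pochhammer_Suc[of B] R_def[symmetric])
    qed
    have 4: "g r = X * K * (1 + A - B + R) * (1 + A + (2 * R + e + 2))"
      using 3 unfolding g_def nn R_def by simp
    have 5: "g (Suc r) = (A + R + 1) * (B + R + 1) * Y * K"
      unfolding g_def 2 using nz1(2) nn(2) by (simp add: R_def add_ac)
    have "(A + 2 * (R + 1)) * (X + Y) * (1 + A - B + R + e + 1) = 
          (A + 2 * (R + 1)) * Y * (1 + A + (2 * R + e + 2)) - ((A + R + 1) * (B + R + 1) * Y - X * (1 + A - B + R) * (1 + A + (2 * R + e + 2)))"
      using XY by algebra
    then have "(A + 2 * (R + 1)) * u (Suc j) (Suc r) = (A + 2 * (R + 1)) * u j (Suc r) - (g (Suc r) - g r)"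
      unfolding 1 2 4 5 by algebra
    then show ?thesis unfolding F_def by (simp add: R_def add_ac)
  qed
  have "(\<Sum>r\<le>Suc j. F (Suc j) r) = F (Suc j) 0 + (\<Sum>r\<le>j. F (Suc j) (Suc r))"
    by (rule sum.atMost_Suc_shift)
  also have "(\<Sum>r\<le>j. F (Suc j) (Suc r)) = (\<Sum>r\<le>j. F j (Suc r)) - (\<Sum>r\<le>j. g (Suc r) - g r)"
    by (simp add: step sum_subtractf)
  also have "(\<Sum>r\<le>j. g (Suc r) - g r) = g (Suc j) - g 0"
    by (induction j) auto
  also have "(\<Sum>r\<le>j. F j (Suc r)) = (\<Sum>r\<le>j. F j r) - F j 0"
    using sum.atMost_Suc_shift[of "F j" j] by (simp add: F_def u0)
  also have "g (Suc j) = 0"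
    by (simp add: g_def u0)
  also have "F (Suc j) 0 = F j 0 - g 0"
    using nz[of j] A[of j]
    by (simp add: F_def g_def u_def pochhammer_Suc divide_simps) (simp add: algebra_simps)
  also have "F j 0 - g 0 + ((\<Sum>r\<le>j. F j r) - F j 0 - (0 - g 0)) = (\<Sum>r\<le>j. F j r)"
    by simp
  also have "(\<Sum>r\<le>j. F j r) = A"
    using Suc.IH by (simp add: F_def u_def mult_ac)
  finally show ?case
    by (simp add: F_def u_def mult_ac)
qed

section \<open>The two inner sums in the form needed for the interchange of summation\<close>

lemma pochhammer_neg_of_nat_eq:
  "pochhammer (- of_nat (k + s)) k / fact (k + s) = ((-1) ^ k / fact s :: 'a :: field_char_0)"
proof -
  have "pochhammer (- of_nat (k + s)) k = (-1) ^ k * pochhammer (1 + of_nat s :: 'a) k"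
    using pochhammer_minus[of "of_nat (k + s) :: 'a" k] by (simp add: add_ac)
  moreover have "fact (k + s) = fact s * pochhammer (1 + of_nat s :: 'a) k"
    unfolding pochhammer_fact using pochhammer_product'[of "1::'a" s k] by (simp add: add.commute)
  moreover have "fact (k + s) \<noteq> (0 :: 'a)"
    by simp
  ultimately show ?thesis
    by (simp only: mult_eq_0_iff de_Morgan_disj) (simp add: field_simps)
qed

lemma pochhammer_neg_of_nat_div_fact:
  "pochhammer (- of_nat j) k / fact k = ((-1) ^ k * of_nat (j choose k) :: 'a :: field_char_0)"
  unfolding binomial_gbinomial gbinomial_pochhammer
  by (simp flip: power_add mult_2 add: mult.assoc[symmetric])

lemma sum_atMost_add_drop:
  fixes f :: "nat \<Rightarrow> 'a :: comm_monoid_add"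
  assumes "\<And>r. r < k \<Longrightarrow> f r = 0"
  shows "(\<Sum>r\<le>k + i. f r) = (\<Sum>s\<le>i. f (k + s))"
proof (induction i)
  case 0
  have "(\<Sum>r\<le>k. f r) = (\<Sum>r\<in>{k}. f r)"
    by (rule sum.mono_neutral_right) (auto simp: assms)
  then show ?case by simp
qed (simp add: add_ac)

text \<open>The extra factors (-r)_k (A + r)_k are those of the k-th summand of \<open>R_hat\<close>
  at t = -r. They kill the terms with r < k; for r = k + s they merge with the rest into the plain
  well-poised sum with A + 2k, B + k, j - k in place of A, B, j.\<close>

lemma well_poised_4F3_shifted:
  fixes A B :: "'a :: field_char_0"
  assumes A: "\<And>n. pochhammer (1 + A) n \<noteq> 0"
    and AB: "\<And>n. pochhammer (1 + A - B) n \<noteq> 0"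
  shows "(\<Sum>r\<le>j. pochhammer A r * (A + 2 * of_nat r) * pochhammer B r *
            pochhammer (- of_nat r) k * pochhammer (A + of_nat r) k /
            (fact r * pochhammer (1 + A - B) r * fact (j - r) * pochhammer (1 + A) (j + r))) =
         A * pochhammer B k * pochhammer (- of_nat j) k / (fact j * pochhammer (1 + A - B) j)"
    (is "(\<Sum>r\<le>j. ?f r) = _")
proof (cases "j < k")
  case True
  then show ?thesis by (simp add: pochhammer_of_nat_eq_0_lemma)
next
  case False
  then obtain i where j: "j = k + i"
    using le_Suc_ex not_less by blast
  define A' where "A' = A + 2 * of_nat k"
  \<comment> \<open>\<open>c\<close> collects what is independent of s after splitting (A)_(2k+s)
    and (1 + A)_(2k+i+s) at 2k.\<close>
  define c where "c = (-1) ^ k * pochhammer A (2 * k) * pochhammer B k /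
      (pochhammer (1 + A) (2 * k) * fact i * pochhammer (1 + A - B) j)"
  have A'0: "pochhammer (1 + A') n \<noteq> 0" for n
    using A[of "2 * k + n"] pochhammer_product'[of "1 + A" "2 * k" n]
    by (simp add: A'_def add_ac)
  have f0: "?f r = 0" if "r < k" for r
    using that by (simp add: pochhammer_of_nat_eq_0_lemma)
  have f: "?f (k + s) = c * (of_nat (i choose s) * (A' + 2 * of_nat s) * pochhammer A' s *
      pochhammer (B + of_nat k) s * pochhammer (1 + A' - (B + of_nat k) + of_nat s) (i - s) /
      pochhammer (1 + A') (i + s))" if s: "s \<le> i" for s
  proof -
    have 1: "pochhammer A (k + s) * pochhammer (A + of_nat (k + s)) k =
             pochhammer A (2 * k) * pochhammer A' s"
    proof -
      have "k + s + k = 2 * k + s" by simp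
      then show ?thesis
        unfolding A'_def by (metis of_nat_mult of_nat_numeral pochhammer_product')
    qed
    have 2: "pochhammer B (k + s) = pochhammer B k * pochhammer (B + of_nat k) s"
      by (rule pochhammer_product')
    have 3: "pochhammer (1 + A) (j + (k + s)) = pochhammer (1 + A) (2 * k) * pochhammer (1 + A') (i + s)"
    proof -
      have "j + (k + s) = 2 * k + (i + s)" by (simp add: j)
      then show ?thesis
        unfolding A'_def using pochhammer_product'[of "1 + A" "2 * k" "i + s"]
        by (simp only: of_nat_mult of_nat_numeral add.assoc)
    qed
    have 4: "pochhammer (1 + A' - (B + of_nat k) + of_nat s) (i - s) =
             pochhammer (1 + A - B) j / pochhammer (1 + A - B) (k + s)"
      using pochhammer_product'[of "1 + A - B" "k + s" "i - s"] s AB[of "k + s"]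
      unfolding A'_def by (simp add: j field_simps)
    have 5: "of_nat (i choose s) = fact i / (fact s * fact (i - s) :: 'a)"
      using s by (rule binomial_fact)
    have "?f (k + s) = (pochhammer A (k + s) * pochhammer (A + of_nat (k + s)) k) *
        (A' + 2 * of_nat s) * pochhammer B (k + s) *
        (pochhammer (- of_nat (k + s)) k / fact (k + s)) /
        (pochhammer (1 + A - B) (k + s) * fact (i - s) * pochhammer (1 + A) (j + (k + s)))"
    proof -
      have "A + 2 * of_nat (k + s) = A' + 2 * of_nat s" "j - (k + s) = i - s"
        by (simp_all add: A'_def j algebra_simps)
      then show ?thesis
        by (simp add: mult_ac del: of_nat_add)
    qed
    also have "\<dots> = c * (of_nat (i choose s) * (A' + 2 * of_nat s) * pochhammer A' s *
      pochhammer (B + of_nat k) s * pochhammer (1 + A' - (B + of_nat k) + of_nat s) (i - s) /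
      pochhammer (1 + A') (i + s))"
      unfolding 1 2 3 4 5 pochhammer_neg_of_nat_eq c_def
      using AB[of j] by (simp add: mult_ac)
    finally show ?thesis .
  qed
  have "(\<Sum>r\<le>j. ?f r) = (\<Sum>s\<le>i. ?f (k + s))"
    unfolding j by (rule sum_atMost_add_drop) (use f0 j in simp)
  also have "\<dots> = c * A'"
  proof -
    have "(\<Sum>s\<le>i. ?f (k + s)) = c * (\<Sum>s\<le>i. of_nat (i choose s) * (A' + 2 * of_nat s) *
        pochhammer A' s * pochhammer (B + of_nat k) s *
        pochhammer (1 + A' - (B + of_nat k) + of_nat s) (i - s) / pochhammer (1 + A') (i + s))"
      unfolding sum_distrib_left by (intro sum.cong refl f) simp
    then show ?thesis
      by (simp only: well_poised_4F3[OF A'0])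
  qed
  also have "\<dots> = A * pochhammer B k * (pochhammer (- of_nat j) k / fact j) / pochhammer (1 + A - B) j"
  proof -
    \<comment> \<open>Both sides are (A)_(2k+1); this trades the shifted value \<open>A'\<close> of
      the sum for A.\<close>
    have "pochhammer A (2 * k) * A' = A * pochhammer (1 + A) (2 * k)"
      unfolding A'_def using pochhammer_rec[of A "2 * k"] pochhammer_Suc[of A "2 * k"]
      by (simp add: add_ac)
    moreover have "c * A' = (pochhammer A (2 * k) * A') * ((-1) ^ k * pochhammer B k) /
        (pochhammer (1 + A) (2 * k) * fact i * pochhammer (1 + A - B) j)"
      unfolding c_def by (simp add: mult_ac)
    ultimately have "c * A' = (A * pochhammer (1 + A) (2 * k)) * ((-1) ^ k * pochhammer B k) /
        (pochhammer (1 + A) (2 * k) * fact i * pochhammer (1 + A - B) j)"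
      by (simp only:)
    then show ?thesis
      using A[of "2 * k"] unfolding j pochhammer_neg_of_nat_eq by (simp add: mult_ac)
  qed
  finally show ?thesis by simp
qed

text \<open>With j = r + i this is a balanced 3F2 with upper parameters C + r, D + r, -(N - r) and
  lower parameters 1 + A + 2r, C + D + E - A + r, so Saalschuetz applies.\<close>

lemma saalschuetz_well_poised:
  fixes A C D :: "'a :: field_char_0"
  assumes A: "\<And>n. pochhammer (1 + A) n \<noteq> 0"
    and AC: "\<And>n. pochhammer (1 + A - C) n \<noteq> 0"
    and AD: "\<And>n. pochhammer (1 + A - D) n \<noteq> 0"
    and ACD: "\<And>n. pochhammer (1 + A - C - D) n \<noteq> 0"
    and E: "E = - of_nat N"
    and r: "r \<le> N"
  shows "(\<Sum>j=r..N. pochhammer C j * pochhammer D j * pochhammer E j /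
            (pochhammer (C + D + E - A) j * fact (j - r) * pochhammer (1 + A) (j + r))) =
         (-1) ^ r * pochhammer C r * pochhammer D r * pochhammer E r /
           (pochhammer (1 + A - C) r * pochhammer (1 + A - D) r * pochhammer (1 + A - E) r) *
         (pochhammer (1 + A - C) N * pochhammer (1 + A - D) N /
           (pochhammer (1 + A - C - D) N * pochhammer (1 + A) N))"
    (is "(\<Sum>j=r..N. ?f j) = _")
proof -
  \<comment> \<open>This is c - a - b for the shifted parameters C + r, D + r, 1 + A + 2r; the
    shifts by r cancel.\<close>
  define x where "x = 1 + A - C - D"
  define M where "M = N - r"
  have N: "N = r + M"
    using r by (simp add: M_def)
  have E_poch: "pochhammer E j = (-1) ^ j * fact N / fact (N - j)" if "j \<le> N" for j
    using pochhammer_neg_of_nat_eq[of j "N - j", where ?'a = 'a] that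
    by (simp add: E field_simps)
  \<comment> \<open>Since C + D + E - A = 1 - x - N, reflecting both Pochhammer symbols produces the
    same sign (-1)^j, which cancels.\<close>
  have ratio: "pochhammer E j / pochhammer (C + D + E - A) j =
      fact N / fact (N - j) * pochhammer x (N - j) / pochhammer x N" if j: "j \<le> N" for j
  proof -
    have "pochhammer (C + D + E - A) j = pochhammer (- (x + of_nat N - 1)) j"
      by (simp add: x_def E algebra_simps)
    also have "\<dots> = (-1) ^ j * pochhammer (x + of_nat (N - j)) j"
      using pochhammer_minus[of "x + of_nat N - 1" j] j by (simp add: of_nat_diff algebra_simps)
    finally have q: "pochhammer (C + D + E - A) j = (-1) ^ j * pochhammer (x + of_nat (N - j)) j" .
    have xN: "pochhammer x N = pochhammer x (N - j) * pochhammer (x + of_nat (N - j)) j"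
      using pochhammer_product'[of x "N - j" j] j by simp
    have "pochhammer x (N - j) \<noteq> 0"
      using ACD by (simp add: x_def)
    then show ?thesis
      unfolding q xN E_poch[OF j] by simp
  qed
  define K where "K = fact N * pochhammer C r * pochhammer D r /
      (pochhammer x N * fact M * pochhammer (1 + A) (N + r))"
  have f: "?f (r + i) = K * (of_nat (M choose i) * pochhammer (C + of_nat r) i *
      pochhammer (D + of_nat r) i * pochhammer (1 + A + 2 * of_nat r + of_nat i) (M - i) *
      pochhammer x (M - i))" if i: "i \<le> M" for i
  proof -
    have 1: "pochhammer (1 + A) (r + i + r) =
        pochhammer (1 + A) (N + r) / pochhammer (1 + A + 2 * of_nat r + of_nat i) (M - i)"
    proof -
      have "pochhammer (1 + A) (N + r) =
          pochhammer (1 + A) (r + i + r) * pochhammer (1 + A + 2 * of_nat r + of_nat i) (M - i)"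
        using pochhammer_product'[of "1 + A" "r + i + r" "M - i"] i
        by (simp add: N algebra_simps mult_2)
      moreover have "pochhammer (1 + A) (N + r) \<noteq> 0" by (rule A)
      ultimately show ?thesis by (auto simp: field_simps)
    qed
    have 2: "of_nat (M choose i) = fact M / (fact i * fact (M - i) :: 'a)"
      using i by (rule binomial_fact)
    have "?f (r + i) = pochhammer C (r + i) * pochhammer D (r + i) *
        (pochhammer E (r + i) / pochhammer (C + D + E - A) (r + i)) /
        (fact i * pochhammer (1 + A) (r + i + r))"
      by simp
    also have "\<dots> = pochhammer C (r + i) * pochhammer D (r + i) *
        (fact N / fact (M - i) * pochhammer x (M - i) / pochhammer x N) /
        (fact i * pochhammer (1 + A) (r + i + r))"
      using ratio[of "r + i"] i by (simp add: N)
    finally show ?thesis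
      unfolding 1 2 pochhammer_product'[of C] pochhammer_product'[of D] K_def by (simp add: mult_ac)
  qed
  have "(\<Sum>j=r..N. ?f j) = (\<Sum>i\<le>M. ?f (r + i))"
    using sum.shift_bounds_cl_nat_ivl[of ?f 0 r M] unfolding N atMost_atLeast0
    by (simp only: add_0_right add.commute[of _ r])
  also have "\<dots> = K * (\<Sum>i\<le>M. of_nat (M choose i) * pochhammer (C + of_nat r) i *
      pochhammer (D + of_nat r) i * pochhammer (1 + A + 2 * of_nat r + of_nat i) (M - i) *
      pochhammer x (M - i))"
    unfolding sum_distrib_left by (intro sum.cong refl f) simp
  also have "(\<Sum>i\<le>M. of_nat (M choose i) * pochhammer (C + of_nat r) i *
      pochhammer (D + of_nat r) i * pochhammer (1 + A + 2 * of_nat r + of_nat i) (M - i) *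
      pochhammer x (M - i)) =
      pochhammer (1 + A - C + of_nat r) M * pochhammer (1 + A - D + of_nat r) M"
    using saalschuetz[of M "C + of_nat r" "D + of_nat r" "1 + A + 2 * of_nat r"]
    by (simp add: x_def algebra_simps)
  also have "pochhammer (1 + A - C + of_nat r) M = pochhammer (1 + A - C) N / pochhammer (1 + A - C) r"
    using AC[of r] by (simp add: N pochhammer_product')
  also have "pochhammer (1 + A - D + of_nat r) M = pochhammer (1 + A - D) N / pochhammer (1 + A - D) r"
    using AD[of r] by (simp add: N pochhammer_product')
  \<comment> \<open>Uses 1 + A - E = 1 + A + N, and that N! / (N - r)! is (E)_r up to the sign
    (-1)^r.\<close>
  also have "K = (-1) ^ r * pochhammer C r * pochhammer D r * pochhammer E r /
      (pochhammer (1 + A - E) r * pochhammer x N * pochhammer (1 + A) N)"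
  proof -
    have "pochhammer (1 + A) (N + r) = pochhammer (1 + A) N * pochhammer (1 + A - E) r"
      by (simp add: E pochhammer_product')
    then show ?thesis
      unfolding K_def E_poch[OF r] M_def
      by (simp add: mult_ac flip: power_add mult_2 mult.assoc[of "(-1) ^ r" "(-1) ^ r"])
  qed
  finally show ?thesis
    by (simp add: x_def)
qed

section \<open>Newton's forward difference formula\<close>

text \<open>Induction on the degree bound: passing to q(x) = p(x) - p(x + 1) lowers the degree and
  turns the signed difference of order k + 1 into that of order k. The inner sum has sign (-1)^i
  rather than (-1)^(k-i), whence the outer (-1)^k.\<close>

lemma newton_forward:
  fixes p :: "'a :: field_char_0 poly"
  assumes "degree p \<le> m"
  shows "(\<Sum>k\<le>m. (-1) ^ k * of_nat (j choose k) *
            (\<Sum>i\<le>k. (-1) ^ i * of_nat (k choose i) * poly p (of_nat i))) = poly p (of_nat j)"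
  using assms
proof (induction m arbitrary: p j)
  case 0
  then obtain a where "p = [:a:]"
    by (auto elim: degree_eq_zeroE)
  then show ?case by simp
next
  case (Suc m)
  define h where "h = (\<lambda>p k. (\<Sum>i\<le>k. (-1) ^ i * of_nat (k choose i) * poly p (of_nat i) :: 'a))"
  define q where "q = p - pcompose p [:1, 1:]"
  have q: "poly q x = poly p x - poly p (1 + x)" for x
    by (simp add: q_def poly_pcompose)
  have "degree q \<le> m"
  \<comment> \<open>A translation preserves degree and leading coefficient, so the top coefficient
    of \<open>q\<close> cancels.\<close>
  proof (rule degree_le, intro allI impI)
    fix i assume i: "m < i"
    have deg: "degree (pcompose p [:1, 1:]) = degree p"
      by (simp add: degree_pcompose)
    show "coeff q i = 0"
    proof (cases "i = degree p")
      case True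
      have "coeff (pcompose p [:1, 1:]) (degree p) = lead_coeff p"
        using lead_coeff_comp[of "[:1, 1:]" p] deg by simp
      then show ?thesis
        by (simp add: q_def True)
    next
      case False
      then have "degree p < i"
        using i Suc.prems by linarith
      then show ?thesis
        using deg by (simp add: q_def coeff_eq_0)
    qed
  qed
  then have IH: "(\<Sum>k\<le>m. (-1) ^ k * of_nat (j choose k) * h q k) = poly q (of_nat j)" for j
    using Suc.IH[of q] by (simp add: h_def)
  have h_Suc: "h p (Suc k) = h q k" for k
  proof -
    have "h p (Suc k) = poly p 0 + (\<Sum>i\<le>k. (-1) ^ Suc i * of_nat (k choose Suc i) * poly p (of_nat (Suc i)))
        - (\<Sum>i\<le>k. (-1) ^ i * of_nat (k choose i) * poly p (of_nat (Suc i)))"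
      unfolding h_def sum.atMost_Suc_shift
      by (simp add: ring_distribs sum.distrib sum_negf sum_subtractf)
    also have "poly p 0 + (\<Sum>i\<le>k. (-1) ^ Suc i * of_nat (k choose Suc i) * poly p (of_nat (Suc i))) = h p k"
      using sum.atMost_Suc_shift[of "\<lambda>i. (-1) ^ i * of_nat (k choose i) * poly p (of_nat i)" k]
      by (simp add: h_def binomial_eq_0)
    finally show ?thesis
      by (simp add: h_def q ring_distribs sum_subtractf)
  qed
  have "(\<Sum>k\<le>Suc m. (-1) ^ k * of_nat (j choose k) * h p k) = poly p (of_nat j)"
  \<comment> \<open>Pascal's rule in j gives S(j + 1) = S(j) - q(j), the same recurrence as p(j + 1)
    = p(j) - q(j).\<close>
  proof (induction j)
    case 0
    show ?case
      by (simp add: sum.atMost_Suc_shift h_def del: sum.atMost_Suc)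
  next
    case (Suc j)
    have "(\<Sum>k\<le>Suc m. (-1) ^ k * of_nat (Suc j choose k) * h p k) =
        (\<Sum>k\<le>Suc m. (-1) ^ k * of_nat (j choose k) * h p k) -
        (\<Sum>k\<le>m. (-1) ^ k * of_nat (j choose k) * h q k)"
      unfolding sum.atMost_Suc_shift h_Suc
      by (simp add: ring_distribs sum.distrib sum_negf sum_subtractf)
    then show ?case
      using Suc.IH IH[of j] by (simp add: q)
  qed
  then show ?case by (simp add: h_def)
qed

section \<open>Bailey's transformation\<close>

text \<open>Up to the constant, both sides are one double sum over r \<le> j \<le> N: summing first
  over j gives the left side by Saalschuetz, summing first over r gives the right side by the
  shifted 4F3. The coefficients \<open>h\<close> stay arbitrary, as the argument is linear in
  them.\<close>

lemma bailey_well_poised: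
  fixes A B C D :: "'a :: field_char_0" and h :: "nat \<Rightarrow> 'a"
  assumes A0: "A \<noteq> 0"
    and A: "\<And>n. pochhammer (1 + A) n \<noteq> 0"
    and AB: "\<And>n. pochhammer (1 + A - B) n \<noteq> 0"
    and AC: "\<And>n. pochhammer (1 + A - C) n \<noteq> 0"
    and AD: "\<And>n. pochhammer (1 + A - D) n \<noteq> 0"
    and ACD: "\<And>n. pochhammer (1 + A - C - D) n \<noteq> 0"
    and B: "\<And>k. k \<le> m \<Longrightarrow> pochhammer B k \<noteq> 0"
    and E: "E = - of_nat N"
  shows "(\<Sum>r\<le>N. (-1) ^ r *
            (pochhammer A r * (A + 2 * of_nat r) * pochhammer B r *
             pochhammer C r * pochhammer D r * pochhammer E r) /
            (A * fact r * pochhammer (1 + A - B) r * pochhammer (1 + A - C) r *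
             pochhammer (1 + A - D) r * pochhammer (1 + A - E) r) *
            (\<Sum>k\<le>m. h k * pochhammer (- of_nat r) k * pochhammer (A + of_nat r) k /
               (pochhammer B k * fact k))) =
         pochhammer (1 + A - C - D) N * pochhammer (1 + A) N /
           (pochhammer (1 + A - C) N * pochhammer (1 + A - D) N) *
         (\<Sum>j\<le>N. pochhammer C j * pochhammer D j * pochhammer E j /
            (pochhammer (1 + A - B) j * pochhammer (C + D + E - A) j * fact j) *
            (\<Sum>k\<le>m. h k * pochhammer (- of_nat j) k / fact k))"
    (is "(\<Sum>r\<le>N. ?L r) = ?c * (\<Sum>j\<le>N. ?R j)")
proof -
  \<comment> \<open>The summand is factored into a part in r, a part in j, and the Bailey kernel 1 /
    ((j - r)! (1 + A)_(j+r)).\<close>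
  define al where "al = (\<lambda>r. pochhammer A r * (A + 2 * of_nat r) * pochhammer B r /
      (A * fact r * pochhammer (1 + A - B) r) *
      (\<Sum>k\<le>m. h k * pochhammer (- of_nat r) k * pochhammer (A + of_nat r) k /
        (pochhammer B k * fact k)))"
  define dl where "dl = (\<lambda>j. pochhammer C j * pochhammer D j * pochhammer E j /
      pochhammer (C + D + E - A) j)"
  define w where "w = (\<lambda>r j. fact (j - r) * pochhammer (1 + A) (j + r) :: 'a)"
  have L: "?L r = ?c * (\<Sum>j | j \<in> {..N} \<and> r \<le> j. al r * dl j / w r j)" if r: "r \<le> N" for r
  proof -
    have set: "{j. j \<in> {..N} \<and> r \<le> j} = {r..N}"
      by auto
    have c: "?c * (pochhammer (1 + A - C) N * pochhammer (1 + A - D) N /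
           (pochhammer (1 + A - C - D) N * pochhammer (1 + A) N)) = 1"
      using A[of N] AC[of N] AD[of N] ACD[of N] by simp
    have "(\<Sum>j=r..N. al r * dl j / w r j) = al r * (\<Sum>j=r..N. dl j / w r j)"
      by (simp add: sum_distrib_left)
    also have "(\<Sum>j=r..N. dl j / w r j) =
         (-1) ^ r * pochhammer C r * pochhammer D r * pochhammer E r /
           (pochhammer (1 + A - C) r * pochhammer (1 + A - D) r * pochhammer (1 + A - E) r) *
         (pochhammer (1 + A - C) N * pochhammer (1 + A - D) N /
           (pochhammer (1 + A - C - D) N * pochhammer (1 + A) N))"
      using saalschuetz_well_poised[OF A AC AD ACD E r]
      by (simp add: dl_def w_def mult_ac)
    finally have "?c * (\<Sum>j=r..N. al r * dl j / w r j) = al r *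
         ((-1) ^ r * pochhammer C r * pochhammer D r * pochhammer E r /
           (pochhammer (1 + A - C) r * pochhammer (1 + A - D) r * pochhammer (1 + A - E) r)) *
         (?c * (pochhammer (1 + A - C) N * pochhammer (1 + A - D) N /
           (pochhammer (1 + A - C - D) N * pochhammer (1 + A) N)))"
      by (simp only: mult_ac)
    then show ?thesis
      unfolding set c by (simp add: al_def mult_ac)
  qed
  have R: "(\<Sum>r | r \<in> {..N} \<and> r \<le> j. al r * dl j / w r j) = ?R j" if j: "j \<le> N" for j
  proof -
    have set: "{r. r \<in> {..N} \<and> r \<le> j} = {..j}"
      using j by auto
    define b where "b = (\<lambda>k r. pochhammer A r * (A + 2 * of_nat r) * pochhammer B r *
            pochhammer (- of_nat r) k * pochhammer (A + of_nat r) k /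
            (fact r * pochhammer (1 + A - B) r * fact (j - r) * pochhammer (1 + A) (j + r)))"
    have "(\<Sum>r\<le>j. al r * dl j / w r j) =
        (\<Sum>r\<le>j. \<Sum>k\<le>m. dl j * (h k / (A * pochhammer B k * fact k)) * b k r)"
      by (intro sum.cong refl)
         (simp add: al_def w_def b_def sum_distrib_left sum_distrib_right sum_divide_distrib mult_ac)
    \<comment> \<open>Each k has its own closed inner sum, whose factor (B)_k cancels the
      denominator (B)_k from \<open>R_hat\<close>.\<close>
    also have "\<dots> = (\<Sum>k\<le>m. dl j * (h k / (A * pochhammer B k * fact k)) * (\<Sum>r\<le>j. b k r))"
      by (subst sum.swap) (simp add: sum_distrib_left)
    also have "\<dots> = (\<Sum>k\<le>m. dl j / (fact j * pochhammer (1 + A - B) j) *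
        (h k * pochhammer (- of_nat j) k / fact k))"
    proof (intro sum.cong refl)
      fix k assume "k \<in> {..m}"
      then have "pochhammer B k \<noteq> 0"
        using B by simp
      moreover have "(\<Sum>r\<le>j. b k r) =
          A * pochhammer B k * pochhammer (- of_nat j) k / (fact j * pochhammer (1 + A - B) j)"
        unfolding b_def by (rule well_poised_4F3_shifted[OF A AB])
      ultimately show "dl j * (h k / (A * pochhammer B k * fact k)) * (\<Sum>r\<le>j. b k r) =
          dl j / (fact j * pochhammer (1 + A - B) j) * (h k * pochhammer (- of_nat j) k / fact k)"
        using A0 by (simp add: mult_ac)
    qed
    finally show ?thesis
      unfolding set by (simp add: dl_def sum_distrib_left sum_divide_distrib mult_ac)
  qed
  have "(\<Sum>r\<le>N. ?L r) = (\<Sum>r\<le>N. ?c * (\<Sum>j | j \<in> {..N} \<and> r \<le> j. al r * dl j / w r j))"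
    by (intro sum.cong refl L) simp
  also have "\<dots> = ?c * (\<Sum>r\<le>N. \<Sum>j | j \<in> {..N} \<and> r \<le> j. al r * dl j / w r j)"
    by (rule sum_distrib_left[symmetric])
  also have "(\<Sum>r\<le>N. \<Sum>j | j \<in> {..N} \<and> r \<le> j. al r * dl j / w r j) =
      (\<Sum>j\<le>N. \<Sum>r | r \<in> {..N} \<and> r \<le> j. al r * dl j / w r j)"
    by (rule sum.swap_restrict) simp_all
  also have "\<dots> = (\<Sum>j\<le>N. ?R j)"
    by (intro sum.cong refl R) simp
  finally show ?thesis .
qed

section \<open>Terminating series, parameter ratios and the zeros of the polynomial\<close>

lemma hypergeo_terminating:
  assumes "- of_nat N \<in> set as"
  shows "hypergeo as bs x =
     (\<Sum>n\<le>N. prod_list (map (\<lambda>a. pochhammer a n) as) /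
          (prod_list (map (\<lambda>b. pochhammer b n) bs) * fact n) * x ^ n)"
  unfolding hypergeo_eq_suminf
proof (rule suminf_finite)
  fix n assume "n \<notin> {..N}"
  then have "pochhammer (- of_nat N :: complex) n = 0"
    by (simp add: pochhammer_of_nat_eq_0_lemma)
  then have "prod_list (map (\<lambda>a. pochhammer a n) as) = 0"
    using assms by (force simp: prod_list_zero_iff)
  then show "prod_list (map (\<lambda>a. pochhammer a n) as) /
          (prod_list (map (\<lambda>b. pochhammer b n) bs) * fact n) * x ^ n = 0"
    by simp
qed simp

lemma pochhammer_nonzero:
  fixes z :: "'a :: field_char_0"
  shows "z \<notin> \<int>\<^sub>\<le>\<^sub>0 \<Longrightarrow> pochhammer z n \<noteq> 0"
  by (auto simp: pochhammer_eq_0_iff)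

text \<open>From (f)_j (f + j)_m = (f)_(j+m) = (f)_m (f + m)_j, each ratio (f + m)_j / (f)_j equals
  (f + j)_m / (f)_m, of degree m in j; the degrees add up.\<close>

lemma pochhammer_ratio_polynomial:
  assumes "length fs = length ms" and "\<forall>f \<in> set fs. f \<notin> \<int>\<^sub>\<le>\<^sub>0"
  shows "\<exists>p. degree p \<le> sum_list ms \<and>
           (\<forall>j. poly p (of_nat j) = prod_list (map (\<lambda>f. pochhammer f j) (shift_params fs ms)) /
                                    prod_list (map (\<lambda>f. pochhammer f j) fs))"
  using assms
proof (induction fs ms rule: list_induct2)
  case Nil
  show ?case by (rule exI[of _ 1]) (simp add: shift_params_def)
next
  case (Cons f fs m ms)
  then obtain p where p: "degree p \<le> sum_list ms"
    "\<And>j. poly p (of_nat j) = prod_list (map (\<lambda>f. pochhammer f j) (shift_params fs ms)) /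
                                    prod_list (map (\<lambda>f. pochhammer f j) fs)"
    by auto
  define q where "q = smult (1 / pochhammer f m) (pochhammer [:f, 1:] m)"
  have f: "pochhammer f n \<noteq> 0" for n
    using Cons.prems by (simp add: pochhammer_nonzero)
  have "degree (pochhammer [:f, 1:] m) \<le> m"
  proof (induction m)
    case (Suc m)
    have "[:f, 1:] + of_nat m = [:f + of_nat m, 1:]"
      by (simp add: of_nat_poly)
    then show ?case
      using Suc degree_mult_le[of "pochhammer [:f, 1:] m" "[:f + of_nat m, 1:]"]
      by (simp add: pochhammer_Suc del: mult_pCons_right)
  qed simp
  then have "degree (q * p) \<le> sum_list (m # ms)"
    using p(1) degree_mult_le[of "pochhammer [:f, 1:] m" p] by (simp add: q_def)
  moreover have "poly q (of_nat j) = pochhammer (f + of_nat m) j / pochhammer f j" for j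
  proof -
    have "poly (pochhammer [:f, 1:] m) (of_nat j) = pochhammer (f + of_nat j) m"
      by (simp add: pochhammer_prod poly_prod add_ac)
    moreover have "pochhammer f j * pochhammer (f + of_nat j) m =
        pochhammer f m * pochhammer (f + of_nat m) j"
      by (metis add.commute pochhammer_product')
    ultimately show ?thesis
      using f by (simp add: q_def field_simps)
  qed
  ultimately show ?case
    by (intro exI[of _ "q * p"]) (simp add: p shift_params_def)
qed

text \<open>(z + 1)_n / (z)_n = (z + n) / z = (-n - z) / (0 - z) is the share of the root z in R(-n)
  / R(0); the leading coefficient cancels.\<close>

lemma pochhammer_shifted_roots:
  fixes R :: "complex poly"
  assumes "mset \<eta> = proots R" and "poly R 0 \<noteq> 0" and "\<forall>z \<in> set \<eta>. z \<notin> \<int>\<^sub>\<le>\<^sub>0"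
  shows "prod_list (map (\<lambda>a. pochhammer a n) (map (\<lambda>z. z + 1) \<eta>)) /
           prod_list (map (\<lambda>b. pochhammer b n) \<eta>) = poly R (- of_nat n) / poly R 0"
proof -
  have "smult (lead_coeff R) (prod_list (map (\<lambda>z. [:- z, 1:]) \<eta>)) = R"
    using complex_poly_decompose_multiset[of R]
    by (simp add: assms(1)[symmetric] flip: prod_mset_prod_list)
  moreover have "poly (prod_list (map (\<lambda>z. [:- z, 1:]) \<eta>)) t = prod_list (map (\<lambda>z. t - z) \<eta>)" for t
    by (induction \<eta>) (auto simp: algebra_simps)
  moreover define G where "G = (\<lambda>t. prod_list (map (\<lambda>z. t - z) \<eta>))"
  ultimately have R: "poly R t = lead_coeff R * G t" for t
    by (metis poly_smult)
  have "prod_list (map (\<lambda>a. pochhammer a n) (map (\<lambda>z. z + 1) \<eta>)) /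
           prod_list (map (\<lambda>b. pochhammer b n) \<eta>) =
        prod_list (map (\<lambda>z. - of_nat n - z) \<eta>) / prod_list (map (\<lambda>z. 0 - z) \<eta>)"
    using assms(3)
  proof (induction \<eta>)
    case (Cons z zs)
    have z: "z \<noteq> 0" "pochhammer z n \<noteq> 0"
      using Cons.prems by (auto simp: pochhammer_nonzero)
    have "z * pochhammer (z + 1) n = pochhammer z n * (z + of_nat n)"
      by (simp flip: pochhammer_rec pochhammer_Suc)
    then have "pochhammer (z + 1) n / pochhammer z n = (- of_nat n - z) / (0 - z)"
      using z by (simp add: field_simps)
    then show ?case
      using Cons by (simp add: times_divide_times_eq[symmetric] del: times_divide_times_eq times_divide_eq_right times_divide_eq_left)
  qed simp
  also have "\<dots> = G (- of_nat n) / G 0"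
    by (simp only: G_def)
  also have "\<dots> = poly R (- of_nat n) / poly R 0"
    using assms(2) unfolding R by simp
  finally show ?thesis .
qed

section \<open>Assembling the identity\<close>

theorem mainTheorem16:
  fixes r :: nat and fs :: "complex list" and ms :: "nat list"
    and A B C D E :: complex and \<eta> :: "complex list"
  assumes "length fs = r" and "length ms = r"
    and E: "\<exists>e::int. e < 0 \<and> E = of_int e"
    and zeros: "mset \<eta> = proots (R_hat A B fs ms)"
    and lower_left: "\<forall>b \<in> set ([A / 2, 1 + A - B, 1 + A - C, 1 + A - D, 1 + A - E] @ \<eta>). b \<notin> \<int>\<^sub>\<le>\<^sub>0"
    and lower_right: "\<forall>b \<in> set ([1 + A - B, C + D + E - A] @ fs). b \<notin> \<int>\<^sub>\<le>\<^sub>0"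
    and denominators: "\<forall>k \<le> sum_list ms. pochhammer B k \<noteq> 0"
    and no_poles: "\<forall>z \<in> {1 + A - C - D - E, 1 + A - C, 1 + A - D, 1 + A - E,
                        1 + A, 1 + A - C - D, 1 + A - D - E, 1 + A - C - E}. z \<notin> \<int>\<^sub>\<le>\<^sub>0"
  shows "hypergeo
           ([A, 1 + A / 2, B, C, D, E] @ map (\<lambda>z. z + 1) \<eta>)
           ([A / 2, 1 + A - B, 1 + A - C, 1 + A - D, 1 + A - E] @ \<eta>)
           (- 1)
       = (Gamma (1 + A - C - D - E) * Gamma (1 + A - C) * Gamma (1 + A - D) * Gamma (1 + A - E)) /
         (Gamma (1 + A) * Gamma (1 + A - C - D) * Gamma (1 + A - D - E) * Gamma (1 + A - C - E))
         * hypergeo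
             ([C, D, E] @ shift_params fs ms)
             ([1 + A - B, C + D + E - A] @ fs)
             1"
proof -
  obtain e :: int where "e < 0" "E = of_int e"
    using E by blast
  then have N: "E = - of_nat (nat (- e))"
    by simp
  define N where "N = nat (- e)"
  note N = N[folded N_def]
  define m where "m = sum_list ms"
  define h where "h = (\<lambda>k. hypergeo (- of_nat k # shift_params fs ms) fs 1)"
  have len: "length fs = length ms"
    using assms(1,2) by simp
  have fs: "\<forall>f \<in> set fs. f \<notin> \<int>\<^sub>\<le>\<^sub>0"
    using lower_right by simp
  have A0: "A \<noteq> 0"
    using lower_left by auto
  obtain p where p: "degree p \<le> m"
    "\<And>j. poly p (of_nat j) = prod_list (map (\<lambda>f. pochhammer f j) (shift_params fs ms)) /
                             prod_list (map (\<lambda>f. pochhammer f j) fs)"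
    using pochhammer_ratio_polynomial[OF len fs] unfolding m_def by blast
  \<comment> \<open>(-k)_i / i! is a signed binomial, so \<open>h k\<close> is up to sign the k-th
    difference at 0 of the polynomial \<open>p\<close> that interpolates the parameter
    ratio.\<close>
  have h_eq: "h k = (\<Sum>i\<le>k. (-1) ^ i * of_nat (k choose i) * poly p (of_nat i))" for k
  proof -
    have "h k = (\<Sum>i\<le>k. pochhammer (- of_nat k) i / fact i *
        (prod_list (map (\<lambda>f. pochhammer f i) (shift_params fs ms)) /
         prod_list (map (\<lambda>f. pochhammer f i) fs)))"
      unfolding h_def by (subst hypergeo_terminating[of k]) (simp_all add: mult_ac)
    then show ?thesis
      by (simp add: pochhammer_neg_of_nat_div_fact p(2))
  qed
  \<comment> \<open>Newton's formula at j: the k-sum on the right of Bailey's transformation is the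
    factor that f + m over f contributes to the j-th term.\<close>
  have P: "(\<Sum>k\<le>m. h k * pochhammer (- of_nat j) k / fact k) =
      prod_list (map (\<lambda>f. pochhammer f j) (shift_params fs ms)) /
      prod_list (map (\<lambda>f. pochhammer f j) fs)" for j
  proof -
    have "h k * pochhammer (- of_nat j) k / fact k = (-1) ^ k * of_nat (j choose k) * h k" for k
      unfolding pochhammer_neg_of_nat_div_fact[symmetric] by simp
    then show ?thesis
      using newton_forward[OF p(1)] p(2) by (simp add: h_eq)
  qed
  define F where "F = pochhammer_vec fs ms"
  have "F \<noteq> 0"
    using len fs unfolding F_def pochhammer_vec_def
    by (induction fs ms rule: list_induct2) (auto simp: pochhammer_nonzero)
  have R: "poly (R_hat A B fs ms) t = F *
      (\<Sum>k\<le>m. h k * pochhammer t k * pochhammer (A - t) k / (pochhammer B k * fact k))" for t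
    by (simp add: poly_R_hat F_def h_def m_def sum_distrib_left mult_ac)
  \<comment> \<open>At t = 0 only k = 0 survives, so R(0) is the nonzero prefactor \<open>F\<close>,
    which then cancels in R(-n) / R(0).\<close>
  have "poly (R_hat A B fs ms) 0 = F * h 0"
  proof -
    have "(\<Sum>k\<le>m. h k * pochhammer 0 k * pochhammer (A - 0) k / (pochhammer B k * fact k)) =
        (\<Sum>k\<in>{0}. h k * pochhammer 0 k * pochhammer (A - 0) k / (pochhammer B k * fact k))"
      by (rule sum.mono_neutral_right) (auto simp: pochhammer_0_left)
    then show ?thesis
      unfolding R by simp
  qed
  also have "h 0 = 1"
  proof -
    have "prod_list (map (\<lambda>_. 1) xs) = (1 :: complex)" for xs :: "complex list"
      by (induction xs) auto
    then show ?thesis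
      using p(2)[of 0] by (simp add: h_eq)
  qed
  finally have R0: "poly (R_hat A B fs ms) 0 = F" by simp
  have roots: "prod_list (map (\<lambda>a. pochhammer a n) (map (\<lambda>z. z + 1) \<eta>)) /
      prod_list (map (\<lambda>b. pochhammer b n) \<eta>) =
      (\<Sum>k\<le>m. h k * pochhammer (- of_nat n) k * pochhammer (A + of_nat n) k / (pochhammer B k * fact k))" for n
    using pochhammer_shifted_roots[OF zeros, of n] lower_left \<open>F \<noteq> 0\<close>
    unfolding R0 unfolding R by simp
  \<comment> \<open>As E = -N, the eight Gamma values pair off into four quotients at arguments
    differing by N, that is, Pochhammer symbols of length N.\<close>
  have AN: "1 + A - E = 1 + A + of_nat N" "1 + A - C - D - E = 1 + A - C - D + of_nat N"
    "1 + A - C - E = 1 + A - C + of_nat N" "1 + A - D - E = 1 + A - D + of_nat N"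
    by (simp_all add: N)
  have poles: "1 + A \<notin> \<int>\<^sub>\<le>\<^sub>0" "1 + A - B \<notin> \<int>\<^sub>\<le>\<^sub>0" "1 + A - C \<notin> \<int>\<^sub>\<le>\<^sub>0" "1 + A - D \<notin> \<int>\<^sub>\<le>\<^sub>0" "1 + A - C - D \<notin> \<int>\<^sub>\<le>\<^sub>0"
    using no_poles lower_left by auto
  have "(Gamma (1 + A - C - D - E) * Gamma (1 + A - C) * Gamma (1 + A - D) * Gamma (1 + A - E)) /
         (Gamma (1 + A) * Gamma (1 + A - C - D) * Gamma (1 + A - D - E) * Gamma (1 + A - C - E)) =
      pochhammer (1 + A - C - D) N * pochhammer (1 + A) N /
           (pochhammer (1 + A - C) N * pochhammer (1 + A - D) N)" (is "?G = ?c")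
    unfolding AN using poles by (simp add: pochhammer_Gamma mult_ac)
  moreover have "hypergeo
           ([A, 1 + A / 2, B, C, D, E] @ map (\<lambda>z. z + 1) \<eta>)
           ([A / 2, 1 + A - B, 1 + A - C, 1 + A - D, 1 + A - E] @ \<eta>)
           (- 1) = (\<Sum>r\<le>N. (-1) ^ r *
            (pochhammer A r * (A + 2 * of_nat r) * pochhammer B r *
             pochhammer C r * pochhammer D r * pochhammer E r) /
            (A * fact r * pochhammer (1 + A - B) r * pochhammer (1 + A - C) r *
             pochhammer (1 + A - D) r * pochhammer (1 + A - E) r) *
            (\<Sum>k\<le>m. h k * pochhammer (- of_nat r) k * pochhammer (A + of_nat r) k /
               (pochhammer B k * fact k)))"
  proof -
    \<comment> \<open>The pair 1 + A/2 over A/2 supplies the very well-poised factor.\<close>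
    have half: "pochhammer (1 + A / 2) n / pochhammer (A / 2) n = (A + 2 * of_nat n) / A" for n
    proof -
      have "A / 2 * pochhammer (1 + A / 2) n = pochhammer (A / 2) n * (A / 2 + of_nat n)"
        using pochhammer_rec[of "A / 2" n] pochhammer_Suc[of "A / 2" n] by (simp add: add_ac)
      moreover have "pochhammer (A / 2) n \<noteq> 0"
        using lower_left by (intro pochhammer_nonzero) simp
      ultimately show ?thesis
        using A0 by (simp add: field_simps)
    qed
    have "hypergeo ([A, 1 + A / 2, B, C, D, E] @ map (\<lambda>z. z + 1) \<eta>)
        ([A / 2, 1 + A - B, 1 + A - C, 1 + A - D, 1 + A - E] @ \<eta>) (- 1) =
        (\<Sum>n\<le>N. (-1) ^ n * (pochhammer A n * pochhammer B n * pochhammer C n * pochhammer D n * pochhammer E n) /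
          (fact n * pochhammer (1 + A - B) n * pochhammer (1 + A - C) n *
            pochhammer (1 + A - D) n * pochhammer (1 + A - E) n) *
          (pochhammer (1 + A / 2) n / pochhammer (A / 2) n) *
          (prod_list (map (\<lambda>a. pochhammer a n) (map (\<lambda>z. z + 1) \<eta>)) /
            prod_list (map (\<lambda>b. pochhammer b n) \<eta>)))"
      by (subst hypergeo_terminating[of N]) (simp_all add: N mult_ac)
    then show ?thesis
      unfolding roots half by (simp add: mult_ac)
  qed
  moreover have "hypergeo ([C, D, E] @ shift_params fs ms) ([1 + A - B, C + D + E - A] @ fs) 1 =
      (\<Sum>j\<le>N. pochhammer C j * pochhammer D j * pochhammer E j /
            (pochhammer (1 + A - B) j * pochhammer (C + D + E - A) j * fact j) *
            (\<Sum>k\<le>m. h k * pochhammer (- of_nat j) k / fact k))"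
    unfolding P by (subst hypergeo_terminating[of N]) (simp_all add: N mult_ac)
  moreover note bailey_well_poised[where A = A and B = B and C = C and D = D and E = E and N = N and h = h and m = m]
  ultimately show ?thesis
    using A0 poles denominators N by (simp add: pochhammer_nonzero m_def)
qed

end
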